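(* Let $\pi:E\to G$ be a trivial Fell bundle with fiber $F$, and let $A$ be a compatible completion of $\Gamma_c(G,F)$. If $A$ is localizable then $G$ is Hausdorff.
   Context: Groupoids. A groupoid $G$ is a topological groupoid with unit space $G_0\subset G$, $d(g)=g^{-1}g$, $r(g)=gg^{-1}$, $G_2=\{(g,h): d(g)=r(h)\}$. Every groupoid is assumed étale ($d$ is a local homeomorphism) with $G_0$ locally compact Hausdorff; $G$ is not assumed Hausdorff. $\Omega(G)$ is the topology of $G$. A local bisection is an open $U\subset G$ on which $d$ and $r$ are injective; $\mathcal I(G)$ is the set of local bisections. Trivial Fell bundles. For a C*-algebra $F$, the product Fell bundle is the projection $F\times G\to G$ with $\|(a,g)\|=\|a\|$, $(a,g)(b,h)=(ab,gh)$ for $(g,h)\in G_2$, and $(a,g)^*=(a^*,g^{-1})$. A trivial Fell bundle with fiber $F$ is one isomorphic to this (fibrewise linear isometrically, preserving product and involution). Its sections are identified with functions $G\to F$. Convolution algebra. For a Hausdorff open $U\subset G$, $C_c(U,F)$ is the space of functions $s:G\to F$ (not necessarily continuous on $G$) that vanish outside $U$, are continuous on $U$, and satisfy $\{g:s(g)\ne0\}\subset K\subset U$ for some compact $K$. The convolution algebra $\Gamma_c(G,F)$ is the linear span of $\bigcup_{U\in\mathcal I(G)}C_c(U,F)$, a $*$-algebra with $st(g)=\sum_{g=hk}s(h)t(k)$ and $s^*(g)=s(g^{-1})^*$. Let $\|s\|_\infty=\sup_g\|s(g)\|$. A compatible norm is a C*-norm $\|\cdot\|$ on $\Gamma_c(G,F)$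 with $\|s\|_\infty\le\|s\|$ for all $s$ and $\|s\|_\infty=\|s\|$ if $s\in C_c(U,F)$ for some $U\in\mathcal I(G)$; the completion $A$ of $\Gamma_c(G,F)$ in a compatible norm is a compatible completion. For $g\in G$, $s\mapsto s(g)$ extends to a continuous linear map $\operatorname{eval}_g:A\to F$. Localizability. For $V\in\Omega(G)$ let $p^*(V)$ be the closed linear span in $A$ of $\bigcup\{C_c(U,F):U\in\mathcal I(G),\ U\subset V\}$. For $a\in A$ let $\sigma(\langle a\rangle)=\operatorname{int}\{g\in G:\operatorname{eval}_g(a)\ne0\}$, and for $V\in\Omega(G)$ let $\gamma(V)=\overline{\operatorname{span}}\{a\in A:\sigma(\langle a\rangle)\subset V\}$. $A$ is localizable if $p^*(V)=\gamma(V)$ for all $V\in\Omega(G)$.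
   Formalization: The fiber F is assumed to be nonzero; for F = 0 the claim fails, since then A = 0 is localizable for every étale groupoid G, including non-Hausdorff ones. *)

theory Defs
  imports "HOL-Analysis.Analysis" "HOL-Library.Function_Algebras"
begin

section \<open>Complex C*-algebras\<close>

class scaleC =
  fixes scaleC :: "complex \<Rightarrow> 'a \<Rightarrow> 'a" (infixr \<open>*\<^sub>C\<close> 75)

text \<open>Not necessarily unital, and the zero algebra is included.\<close>

class cstar_algebra = real_normed_algebra + banach + scaleC +
  fixes star :: "'a \<Rightarrow> 'a"
  assumes scaleC_add_right: "c *\<^sub>C (x + y) = c *\<^sub>C x + c *\<^sub>C y"
    and scaleC_add_left: "(c + c') *\<^sub>C x = c *\<^sub>C x + c' *\<^sub>C x"
    and scaleC_scaleC: "c *\<^sub>C (c' *\<^sub>C x) = (c * c') *\<^sub>C x"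
    and scaleC_one: "1 *\<^sub>C x = x"
    and scaleR_scaleC: "a *\<^sub>R x = complex_of_real a *\<^sub>C x"
    and norm_scaleC: "norm (c *\<^sub>C x) = cmod c * norm x"
    and mult_scaleC_left: "(c *\<^sub>C x) * y = c *\<^sub>C (x * y)"
    and mult_scaleC_right: "x * (c *\<^sub>C y) = c *\<^sub>C (x * y)"
    and star_add: "star (x + y) = star x + star y"
    and star_scaleC: "star (c *\<^sub>C x) = cnj c *\<^sub>C star x"
    and star_mult: "star (x * y) = star y * star x"
    and star_star: "star (star x) = x"
    and cstar_identity: "norm (star x * x) = (norm x)\<^sup>2"

definition cspan :: "'a::cstar_algebra set \<Rightarrow> 'a set"
  where "cspan S = module.span scaleC S"

definition scale_fun :: "complex \<Rightarrow> ('g \<Rightarrow> 'f::cstar_algebra) \<Rightarrow> 'g \<Rightarrow> 'f"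
  where "scale_fun c s = (\<lambda>g. c *\<^sub>C s g)"

lemma vector_space_scaleC: "vector_space (scaleC :: complex \<Rightarrow> 'a \<Rightarrow> 'a::cstar_algebra)"
  by unfold_locales (simp_all add: scaleC_add_right scaleC_add_left scaleC_scaleC scaleC_one)

lemma vector_space_scale_fun:
  "vector_space (scale_fun :: complex \<Rightarrow> ('g \<Rightarrow> 'f::cstar_algebra) \<Rightarrow> 'g \<Rightarrow> 'f)"
  by unfold_locales
    (simp_all add: scale_fun_def fun_eq_iff scaleC_add_right scaleC_add_left scaleC_scaleC scaleC_one)


section \<open>Etale groupoids\<close>

text \<open>The groupoid is the whole type. The product is a total function of which only the values
  on composable pairs matter.\<close>

class groupoid_ops =
  fixes gmult :: "'a \<Rightarrow> 'a \<Rightarrow> 'a" (infixl \<open>\<cdot>\<close> 70)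
    and ginv :: "'a \<Rightarrow> 'a"

definition gdom :: "'g::groupoid_ops \<Rightarrow> 'g"
  where "gdom g = ginv g \<cdot> g"

definition grng :: "'g::groupoid_ops \<Rightarrow> 'g"
  where "grng g = g \<cdot> ginv g"

definition composable :: "('g::groupoid_ops \<times> 'g) set"
  where "composable = {(g, h). gdom g = grng h}"

definition units :: "'g::groupoid_ops set"
  where "units = range gdom"

class groupoid = groupoid_ops +
  assumes ginv_ginv: "ginv (ginv g) = g"
    and gdom_gmult: "gdom g = grng h \<Longrightarrow> gdom (g \<cdot> h) = gdom h"
    and grng_gmult: "gdom g = grng h \<Longrightarrow> grng (g \<cdot> h) = grng g"
    and gmult_assoc: "gdom g = grng h \<Longrightarrow> gdom h = grng k \<Longrightarrow> (g \<cdot> h) \<cdot> k = g \<cdot> (h \<cdot> k)"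
    and ginv_gmult_cancel: "gdom g = grng h \<Longrightarrow> ginv g \<cdot> (g \<cdot> h) = h"
    and gmult_ginv_cancel: "gdom g = grng h \<Longrightarrow> (g \<cdot> h) \<cdot> ginv h = g"

class topological_groupoid = groupoid + topological_space +
  assumes continuous_gmult: "continuous_on composable (\<lambda>(g, h). g \<cdot> h)"
    and continuous_ginv: "continuous_on UNIV ginv"

text \<open>The last axiom says that \<open>gdom\<close> is a local homeomorphism onto the unit space. Only the unit
  space is required to be Hausdorff.\<close>

class etale_groupoid = topological_groupoid +
  assumes Hausdorff_units: "Hausdorff_space (top_of_set units)"
    and locally_compact_units: "locally_compact_space (top_of_set units)"
    and gdom_local_homeomorphism:
      "\<exists>U. open U \<and> g \<in> U \<and> openin (top_of_set units) (gdom ` U) \<and>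
           (\<exists>e. homeomorphism U (gdom ` U) gdom e)"

definition bisections :: "'g::etale_groupoid set set"
  where "bisections = {U. open U \<and> inj_on gdom U \<and> inj_on grng U}"


section \<open>The convolution algebra\<close>

text \<open>\<open>Cc U\<close> is used for bisections \<open>U\<close> only; these are Hausdorff, being homeomorphic to open
  subsets of the unit space.\<close>

definition Cc :: "'g::etale_groupoid set \<Rightarrow> ('g \<Rightarrow> 'f::cstar_algebra) set"
  where "Cc U = {s. (\<forall>g. g \<notin> U \<longrightarrow> s g = 0) \<and> continuous_on U s \<and>
                    (\<exists>K. compact K \<and> {g. s g \<noteq> 0} \<subseteq> K \<and> K \<subseteq> U)}"

definition conv_algebra :: "('g::etale_groupoid \<Rightarrow> 'f::cstar_algebra) set"
  where "conv_algebra = module.span scale_fun (\<Union>U\<in>bisections. Cc U)"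

text \<open>The restriction to pairs with nonzero factors makes the index set finite for \<open>s\<close>, \<open>t\<close> in
  \<open>conv_algebra\<close> (a sum over an infinite set would be \<open>0\<close>) and only drops vanishing summands.\<close>

definition conv ::
    "('g::etale_groupoid \<Rightarrow> 'f::cstar_algebra) \<Rightarrow> ('g \<Rightarrow> 'f) \<Rightarrow> 'g \<Rightarrow> 'f"
  where "conv s t g =
    (\<Sum>(h, k)\<in>{(h, k). (h, k) \<in> composable \<and> h \<cdot> k = g \<and> s h \<noteq> 0 \<and> t k \<noteq> 0}. s h * t k)"

definition conv_star :: "('g::etale_groupoid \<Rightarrow> 'f::cstar_algebra) \<Rightarrow> 'g \<Rightarrow> 'f"
  where "conv_star s g = star (s (ginv g))"

definition norm_sup :: "('g::etale_groupoid \<Rightarrow> 'f::cstar_algebra) \<Rightarrow> real"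
  where "norm_sup s = (SUP g. norm (s g))"

text \<open>Addition and the zero of functions are pointwise; pointwise multiplication of functions is
  never used.\<close>

definition is_cstar_norm :: "(('g::etale_groupoid \<Rightarrow> 'f::cstar_algebra) \<Rightarrow> real) \<Rightarrow> bool"
  where "is_cstar_norm N \<longleftrightarrow>
    (\<forall>s\<in>conv_algebra. N s \<ge> 0 \<and> (N s = 0 \<longleftrightarrow> s = 0)) \<and>
    (\<forall>s\<in>conv_algebra. \<forall>t\<in>conv_algebra. N (s + t) \<le> N s + N t) \<and>
    (\<forall>c. \<forall>s\<in>conv_algebra. N (scale_fun c s) = cmod c * N s) \<and>
    (\<forall>s\<in>conv_algebra. \<forall>t\<in>conv_algebra. N (conv s t) \<le> N s * N t) \<and>
    (\<forall>s\<in>conv_algebra. N (conv (conv_star s) s) = (N s)\<^sup>2)"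

definition compatible_norm :: "(('g::etale_groupoid \<Rightarrow> 'f::cstar_algebra) \<Rightarrow> real) \<Rightarrow> bool"
  where "compatible_norm N \<longleftrightarrow>
    is_cstar_norm N \<and>
    (\<forall>s\<in>conv_algebra. norm_sup s \<le> N s) \<and>
    (\<forall>U\<in>bisections. \<forall>s\<in>Cc U. norm_sup s = N s)"

text \<open>A completion is a C*-algebra together with an isometric *-homomorphism \<open>\<iota>\<close> from
  \<open>conv_algebra\<close> onto a dense subalgebra. Values of \<open>\<iota>\<close> outside \<open>conv_algebra\<close> are irrelevant.\<close>

definition is_completion ::
    "(('g::etale_groupoid \<Rightarrow> 'f::cstar_algebra) \<Rightarrow> real) \<Rightarrow> (('g \<Rightarrow> 'f) \<Rightarrow> 'a::cstar_algebra) \<Rightarrow> bool"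
  where "is_completion N \<iota> \<longleftrightarrow>
    (\<forall>s\<in>conv_algebra. \<forall>t\<in>conv_algebra. \<iota> (s + t) = \<iota> s + \<iota> t) \<and>
    (\<forall>c. \<forall>s\<in>conv_algebra. \<iota> (scale_fun c s) = c *\<^sub>C \<iota> s) \<and>
    (\<forall>s\<in>conv_algebra. \<forall>t\<in>conv_algebra. \<iota> (conv s t) = \<iota> s * \<iota> t) \<and>
    (\<forall>s\<in>conv_algebra. \<iota> (conv_star s) = star (\<iota> s)) \<and>
    (\<forall>s\<in>conv_algebra. norm (\<iota> s) = N s) \<and>
    closure (\<iota> ` conv_algebra) = UNIV"

definition compatible_completion ::
    "(('g::etale_groupoid \<Rightarrow> 'f::cstar_algebra) \<Rightarrow> 'a::cstar_algebra) \<Rightarrow> bool"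
  where "compatible_completion \<iota> \<longleftrightarrow> (\<exists>N. compatible_norm N \<and> is_completion N \<iota>)"

text \<open>The unique continuous linear extension of evaluation at \<open>g\<close>; it exists for compatible
  completions because \<open>norm (s g) \<le> norm_sup s \<le> norm (\<iota> s)\<close>.\<close>

definition eval_at ::
    "(('g::etale_groupoid \<Rightarrow> 'f::cstar_algebra) \<Rightarrow> 'a::cstar_algebra) \<Rightarrow> 'g \<Rightarrow> 'a \<Rightarrow> 'f"
  where "eval_at \<iota> g = (THE e. Vector_Spaces.linear scaleC scaleC e \<and> continuous_on UNIV e \<and>
                               (\<forall>s\<in>conv_algebra. e (\<iota> s) = s g))"


section \<open>Localizability\<close>

definition pstar ::
    "(('g::etale_groupoid \<Rightarrow> 'f::cstar_algebra) \<Rightarrow> 'a::cstar_algebra) \<Rightarrow> 'g set \<Rightarrow> 'a set"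
  where "pstar \<iota> V = closure (cspan (\<Union>U\<in>{U \<in> bisections. U \<subseteq> V}. \<iota> ` Cc U))"

definition open_support ::
    "(('g::etale_groupoid \<Rightarrow> 'f::cstar_algebra) \<Rightarrow> 'a::cstar_algebra) \<Rightarrow> 'a \<Rightarrow> 'g set"
  where "open_support \<iota> a = interior {g. eval_at \<iota> g a \<noteq> 0}"

definition gamma_of ::
    "(('g::etale_groupoid \<Rightarrow> 'f::cstar_algebra) \<Rightarrow> 'a::cstar_algebra) \<Rightarrow> 'g set \<Rightarrow> 'a set"
  where "gamma_of \<iota> V = closure (cspan {a. open_support \<iota> a \<subseteq> V})"

definition localizable ::
    "(('g::etale_groupoid \<Rightarrow> 'f::cstar_algebra) \<Rightarrow> 'a::cstar_algebra) \<Rightarrow> bool"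
  where "localizable \<iota> \<longleftrightarrow> (\<forall>V. open V \<longrightarrow> pstar \<iota> V = gamma_of \<iota> V)"

end

theory Submission
  imports Defs
begin

text \<open>
  Suppose that \<open>g \<noteq> h\<close> have no disjoint neighbourhoods. Since \<open>gdom\<close> is continuous with values in
  the Hausdorff unit space, \<open>gdom g = gdom h = x\<close>. Choose bisections \<open>U\<close> around \<open>g\<close> and \<open>V\<close> around
  \<open>h\<close>, a nonzero element \<open>v\<close> of the fiber, and a real bump function \<open>f\<close> on the unit space with
  \<open>f x = 1\<close> and compact support inside the open set \<open>gdom ` U \<inter> gdom ` V\<close>. Lifting the same
  function \<open>f v\<close> along \<open>gdom\<close> to \<open>U\<close> and to \<open>V\<close>, and extending by zero, gives two sections \<open>s\<close> and
  \<open>t\<close> which agree on \<open>U \<inter> V\<close> (\<open>lifted_bump_in_Cc\<close>).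

  Every neighbourhood of \<open>g\<close> meets \<open>U \<inter> V\<close>, because its intersection with \<open>U\<close> is again a
  neighbourhood of \<open>g\<close> and cannot be disjoint from the neighbourhood \<open>V\<close> of \<open>h\<close>. Hence \<open>g\<close> is not
  interior to the set where \<open>s - t\<close> is nonzero. On the other hand \<open>g \<notin> V\<close>, since \<open>gdom\<close> is
  injective on \<open>V\<close>, and so \<open>(s - t) g = v \<noteq> 0\<close>. The value of \<open>s - t\<close> at \<open>g\<close> is thus invisible to
  its open support \<open>W\<close>.

  Localizability forbids this (\<open>eval_at_outside_open_support\<close>): the element given by \<open>s - t\<close> belongs
  to \<open>gamma_of \<iota> W = pstar \<iota> W\<close>, and every element of \<open>pstar \<iota> W\<close> is a limit of sections that vanish
  at all points outside \<open>W\<close>. This passes to the limit because evaluation at a point is continuous on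
  the completion (\<open>eval_at_pstar\<close>), so \<open>s - t\<close> would vanish at \<open>g\<close>.
\<close>


section \<open>Local bisections\<close>

lemma gdom_ginv: "gdom (ginv g) = grng (g::'g::groupoid)"
  by (simp add: gdom_def grng_def ginv_ginv)

lemma continuous_gdom: "continuous_on UNIV (gdom :: 'g::topological_groupoid \<Rightarrow> 'g)"
proof -
  have "continuous_on UNIV (\<lambda>g::'g. (\<lambda>(g, h). g \<cdot> h) (ginv g, g))"
    by (rule continuous_on_compose2[OF continuous_gmult])
      (auto simp: composable_def gdom_ginv intro!: continuous_intros continuous_ginv)
  then show ?thesis
    by (simp add: gdom_def[abs_def])
qed

lemma gdom_in_units [simp]: "gdom g \<in> units"
  by (simp add: units_def)

lemma gdom_eq_of_inseparable:
  fixes g h :: "'g::etale_groupoid"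
  assumes inseparable: "\<And>A B. open A \<Longrightarrow> open B \<Longrightarrow> g \<in> A \<Longrightarrow> h \<in> B \<Longrightarrow> A \<inter> B \<noteq> {}"
  shows "gdom g = gdom h"
proof (rule ccontr)
  assume "gdom g \<noteq> gdom h"
  with Hausdorff_units obtain A B
    where AB: "openin (top_of_set units) A" "openin (top_of_set units) B"
      "gdom g \<in> A" "gdom h \<in> B" "disjnt A B"
    unfolding Hausdorff_space_def by (metis gdom_in_units topspace_euclidean_subtopology)
  have "open (gdom -` S)" if "openin (top_of_set units) S" for S :: "'g set"
  proof -
    obtain T where "open T" "S = units \<inter> T"
      using \<open>openin (top_of_set units) S\<close> unfolding openin_open by blast
    then show ?thesis
      using open_vimage[OF \<open>open T\<close> continuous_gdom] by (simp add: vimage_def)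
  qed
  with AB inseparable[of "gdom -` A" "gdom -` B"] show False
    by (auto simp: disjnt_def)
qed

text \<open>A local inverse of \<open>gdom\<close> is kept alongside the bisection because it carries compact subsets of
  the unit space back into the bisection.\<close>

lemma bisection_around:
  fixes g :: "'g::etale_groupoid"
  obtains U e where "U \<in> bisections" "g \<in> U" "openin (top_of_set units) (gdom ` U)"
    "homeomorphism U (gdom ` U) gdom e"
proof -
  obtain U e where U: "open U" "g \<in> U" "openin (top_of_set units) (gdom ` U)"
      "homeomorphism U (gdom ` U) gdom e"
    using gdom_local_homeomorphism by blast
  obtain U' e' where U': "open U'" "ginv g \<in> U'" "homeomorphism U' (gdom ` U') gdom e'"
    using gdom_local_homeomorphism by blast
  \<comment> \<open>Inversion turns injectivity of \<open>gdom\<close> near \<open>ginv g\<close> into injectivity of \<open>grng\<close> near \<open>g\<close>.\<close>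
  define B where "B = U \<inter> ginv -` U'"
  have B: "open B" "B \<subseteq> U" "g \<in> B"
    using U U' open_vimage[OF U'(1) continuous_ginv] by (auto simp: B_def)
  have hom: "homeomorphism B (gdom ` B) gdom e"
    using homeomorphism_of_subsets[OF U(4) B(2)] B(2) by blast
  have "openin (top_of_set (gdom ` U)) (gdom ` B)"
    using homeomorphism_imp_open_map[OF U(4)] B by (simp add: open_subset)
  then have op: "openin (top_of_set units) (gdom ` B)"
    using U(3) openin_trans by blast
  have "inj_on gdom B"
    using hom by (metis homeomorphism_apply1 inj_onI)
  moreover have "inj_on grng B"
  proof (rule inj_onI)
    fix a b
    assume ab: "a \<in> B" "b \<in> B" "grng a = grng b"
    then have "ginv a \<in> U'" "ginv b \<in> U'" "gdom (ginv a) = gdom (ginv b)"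
      by (auto simp: B_def gdom_ginv)
    then have "ginv a = ginv b"
      using U'(3) by (metis homeomorphism_apply1)
    then show "a = b"
      by (metis ginv_ginv)
  qed
  ultimately have "B \<in> bisections"
    using B by (simp add: bisections_def)
  then show thesis
    using that B hom op by blast
qed


section \<open>Compactly supported sections\<close>

lemma locally_compact_Hausdorff_bump:
  assumes "locally_compact_space X" "Hausdorff_space X" "openin X W" "x \<in> W"
  obtains f K where "continuous_map X euclideanreal f" "f x = 1" "compactin X K" "K \<subseteq> W"
    "\<And>y. y \<in> topspace X \<Longrightarrow> f y \<noteq> 0 \<Longrightarrow> y \<in> K"
proof -
  obtain O' K where OK: "openin X O'" "compactin X K" "x \<in> O'" "O' \<subseteq> K" "K \<subseteq> W"
    using assms locally_compact_space_neighbourhood_base[of X] unfolding neighbourhood_base_of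
    by metis
  obtain f where f: "continuous_map X euclideanreal f" "f x = 0" "f ` (topspace X - O') \<subseteq> {1}"
    using locally_compact_regular_imp_completely_regular_space[of X] assms OK
    unfolding completely_regular_space_alt' by metis
  show thesis
  proof (rule that[of "\<lambda>y. 1 - f y" K])
    show "continuous_map X euclideanreal (\<lambda>y. 1 - f y)"
      using f(1) by (intro continuous_map_diff) auto
    show "y \<in> K" if "y \<in> topspace X" "1 - f y \<noteq> 0" for y
      using that f(3) OK(4) by force
  qed (use f OK in auto)
qed

lemma lifted_bump_in_Cc:
  fixes U :: "'g::etale_groupoid set" and v :: "'f::cstar_algebra"
  assumes hom: "homeomorphism U (gdom ` U) gdom e"
    and f: "continuous_on units f"
    and K: "compact K" "K \<subseteq> gdom ` U" "\<And>y. y \<in> units \<Longrightarrow> f y \<noteq> 0 \<Longrightarrow> y \<in> K"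
  shows "(\<lambda>k. if k \<in> U then f (gdom k) *\<^sub>R v else 0) \<in> Cc U" (is "?s \<in> _")
proof -
  have "continuous_on U (\<lambda>k. f (gdom k))"
    by (rule continuous_on_compose2[OF f]) (auto intro: continuous_on_subset[OF continuous_gdom])
  then have "continuous_on U (\<lambda>k. f (gdom k) *\<^sub>R v)"
    by (intro continuous_intros)
  then have cont: "continuous_on U ?s"
    by (subst continuous_on_cong[OF refl, where g = "\<lambda>k. f (gdom k) *\<^sub>R v"]) auto
  have comp: "compact (e ` K)"
    using hom K by (meson compact_continuous_image continuous_on_subset homeomorphism_cont2)
  have sub: "e ` K \<subseteq> U"
    using hom K(2) by (auto simp: homeomorphism_def)
  have supp: "k \<in> e ` K" if "?s k \<noteq> 0" for k
  proof -
    have "k \<in> U" "f (gdom k) \<noteq> 0"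
      using that by (auto split: if_splits)
    then have "k = e (gdom k)" "gdom k \<in> K"
      using hom K(3) by (auto simp: homeomorphism_def)
    then show ?thesis
      by blast
  qed
  have "\<exists>L. compact L \<and> {k. ?s k \<noteq> 0} \<subseteq> L \<and> L \<subseteq> U"
    using comp sub supp by blast
  moreover have "\<forall>k. k \<notin> U \<longrightarrow> ?s k = 0"
    by simp
  ultimately show ?thesis
    using cont unfolding Cc_def by blast
qed

interpretation sections:
  vector_space "scale_fun :: complex \<Rightarrow> ('g \<Rightarrow> 'f::cstar_algebra) \<Rightarrow> 'g \<Rightarrow> 'f"
  by (rule vector_space_scale_fun)

lemma Cc_subset_conv_algebra: "U \<in> bisections \<Longrightarrow> Cc U \<subseteq> conv_algebra"
  unfolding conv_algebra_def using sections.span_superset by blast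

lemma conv_algebra_subspace: "sections.subspace conv_algebra"
  unfolding conv_algebra_def by (rule sections.subspace_span)

text \<open>The supremum norm is a supremum of reals and controls the values of a section only once the
  section is known to be bounded.\<close>

lemma conv_algebra_bounded:
  fixes s :: "'g::etale_groupoid \<Rightarrow> 'f::cstar_algebra"
  assumes "s \<in> conv_algebra"
  shows "\<exists>M. \<forall>g. norm (s g) \<le> M"
  using assms unfolding conv_algebra_def
proof (induction rule: sections.span_induct_alt)
  case base
  show ?case
    by (rule exI[of _ 0]) simp
next
  case (step c s t)
  obtain U where U: "s \<in> Cc U"
    using step by blast
  then obtain K where K: "compact K" "{g. s g \<noteq> 0} \<subseteq> K" "K \<subseteq> U" "continuous_on U s"
    by (auto simp: Cc_def)
  then have "bounded (s ` K)"
    by (meson compact_continuous_image compact_imp_bounded continuous_on_subset)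
  then obtain M where M: "\<And>g. g \<in> K \<Longrightarrow> norm (s g) \<le> M"
    by (auto simp: bounded_iff)
  have s: "norm (s g) \<le> max M 0" for g
    using M[of g] K(2) by (cases "s g = 0") auto
  obtain M' where M': "\<And>g. norm (t g) \<le> M'"
    using step by blast
  have "norm ((scale_fun c s + t) g) \<le> cmod c * max M 0 + M'" for g
  proof -
    have "norm ((scale_fun c s + t) g) \<le> cmod c * norm (s g) + norm (t g)"
      using norm_triangle_ineq[of "c *\<^sub>C s g" "t g"] by (simp add: scale_fun_def norm_scaleC)
    also have "\<dots> \<le> cmod c * max M 0 + M'"
      using s M' by (intro add_mono mult_left_mono) auto
    finally show ?thesis .
  qed
  then show ?case
    by blast
qed

lemma norm_le_norm_sup:
  assumes "s \<in> conv_algebra"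
  shows "norm (s g) \<le> norm_sup s"
  unfolding norm_sup_def
  using conv_algebra_bounded[OF assms] by (intro cSUP_upper) (auto simp: bdd_above_def)


section \<open>Evaluation in a compatible completion\<close>

lemma continuous_scaleC: "continuous_on UNIV (\<lambda>x::'a::cstar_algebra. c *\<^sub>C x)"
proof -
  have "bounded_linear (\<lambda>x::'a. c *\<^sub>C x)"
    by (rule bounded_linear_intro[where K = "cmod c"])
      (simp_all add: scaleC_add_right scaleR_scaleC scaleC_scaleC norm_scaleC mult.commute)
  then show ?thesis
    by (rule linear_continuous_on)
qed

lemma closed_property_on_dense:
  assumes "closure D = UNIV" "closed {x. P x}" "\<And>x. x \<in> D \<Longrightarrow> P x"
  shows "P x"
  using closure_minimal[of D "{x. P x}"] assms by blast

context
  fixes \<iota> :: "('g::etale_groupoid \<Rightarrow> 'f::cstar_algebra) \<Rightarrow> 'a::cstar_algebra"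
  assumes completion: "compatible_completion \<iota>"
begin

lemma completion_dense: "closure (\<iota> ` conv_algebra) = UNIV"
  and completion_add: "s \<in> conv_algebra \<Longrightarrow> t \<in> conv_algebra \<Longrightarrow> \<iota> (s + t) = \<iota> s + \<iota> t"
  and completion_scale: "s \<in> conv_algebra \<Longrightarrow> \<iota> (scale_fun c s) = c *\<^sub>C \<iota> s"
  using completion by (auto simp: compatible_completion_def is_completion_def)

lemma norm_le_completion_norm:
  assumes "s \<in> conv_algebra"
  shows "norm (s g) \<le> norm (\<iota> s)"
  using completion norm_le_norm_sup[OF assms, of g] assms
  by (force simp: compatible_completion_def is_completion_def compatible_norm_def)

lemma completion_diff:
  assumes "s \<in> conv_algebra" "t \<in> conv_algebra"
  shows "\<iota> (s - t) = \<iota> s - \<iota> t"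
proof -
  have "s - t \<in> conv_algebra"
    using sections.subspace_diff[OF conv_algebra_subspace] assms by blast
  then have "\<iota> s = \<iota> (s - t) + \<iota> t"
    using completion_add[of "s - t" t] assms by simp
  then show ?thesis
    by simp
qed

text \<open>Evaluation at \<open>g\<close> is \<open>1\<close>-Lipschitz on the dense image of the convolution algebra, hence extends
  to the completion by uniform continuity; linearity of the extension follows by density, one
  argument at a time.\<close>

lemma evaluation_extends:
  "\<exists>e. Vector_Spaces.linear scaleC scaleC e \<and> continuous_on UNIV e \<and>
       (\<forall>s\<in>conv_algebra. e (\<iota> s) = s g)"
proof -
  have diff_le: "norm (s g - t g) \<le> norm (\<iota> s - \<iota> t)"
    if "s \<in> conv_algebra" "t \<in> conv_algebra" for s t
    using norm_le_completion_norm[OF sections.subspace_diff[OF conv_algebra_subspace that], of g]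
    by (simp add: completion_diff that)
  define \<phi> where "\<phi> y = inv_into conv_algebra \<iota> y g" for y
  have \<phi>: "\<phi> (\<iota> s) = s g" if s: "s \<in> conv_algebra" for s
  proof -
    have "inv_into conv_algebra \<iota> (\<iota> s) \<in> conv_algebra"
      "\<iota> (inv_into conv_algebra \<iota> (\<iota> s)) = \<iota> s"
      using inv_into_into[OF imageI[OF s]] f_inv_into_f[OF imageI[OF s]] .
    then show ?thesis
      using diff_le[OF _ s, of "inv_into conv_algebra \<iota> (\<iota> s)"] by (simp add: \<phi>_def)
  qed
  have "uniformly_continuous_on (\<iota> ` conv_algebra) \<phi>"
    unfolding uniformly_continuous_on_def
  proof (intro allI impI)
    fix d :: real
    assume "d > 0"
    moreover have "dist (\<phi> y) (\<phi> x) < d"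
      if xy: "x \<in> \<iota> ` conv_algebra" "y \<in> \<iota> ` conv_algebra" "dist y x < d" for x y
    proof -
      obtain s t where "s \<in> conv_algebra" "x = \<iota> s" "t \<in> conv_algebra" "y = \<iota> t"
        using xy(1,2) by blast
      then show ?thesis
        using diff_le[of t s] xy(3) by (simp add: dist_norm \<phi>)
    qed
    ultimately show "\<exists>r>0. \<forall>x\<in>\<iota> ` conv_algebra. \<forall>y\<in>\<iota> ` conv_algebra.
        dist y x < r \<longrightarrow> dist (\<phi> y) (\<phi> x) < d"
      by blast
  qed
  from uniformly_continuous_on_extension_on_closure[OF this]
  obtain e where e_uc: "uniformly_continuous_on UNIV e"
    and e_ext: "\<And>y. y \<in> \<iota> ` conv_algebra \<Longrightarrow> \<phi> y = e y"
    unfolding completion_dense by metis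
  have cont: "continuous_on UNIV e"
    by (rule uniformly_continuous_imp_continuous[OF e_uc])
  have e: "e (\<iota> s) = s g" if "s \<in> conv_algebra" for s
    using e_ext[of "\<iota> s"] \<phi> that by simp
  have cont_comp: "continuous_on UNIV (\<lambda>x. e (h x))" if "continuous_on UNIV h" for h :: "'a \<Rightarrow> 'a"
    using continuous_on_compose2[OF cont that] by simp
  have add_dense: "e (\<iota> s + y) = e (\<iota> s) + e y" if s: "s \<in> conv_algebra" for s y
  proof (rule closed_property_on_dense[OF completion_dense, of "\<lambda>y. e (\<iota> s + y) = e (\<iota> s) + e y"])
    show "closed {y. e (\<iota> s + y) = e (\<iota> s) + e y}"
      by (intro closed_Collect_eq continuous_intros cont cont_comp)
    fix y
    assume "y \<in> \<iota> ` conv_algebra"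
    then obtain t where t: "t \<in> conv_algebra" "y = \<iota> t"
      by blast
    have "s + t \<in> conv_algebra"
      using sections.subspace_add[OF conv_algebra_subspace] s t by blast
    then show "e (\<iota> s + y) = e (\<iota> s) + e y"
      using e[of "s + t"] e s t by (simp add: completion_add)
  qed
  have add: "e (x + y) = e x + e y" for x y
  proof (rule closed_property_on_dense[OF completion_dense, of "\<lambda>x. e (x + y) = e x + e y"])
    show "closed {x. e (x + y) = e x + e y}"
      by (intro closed_Collect_eq continuous_intros cont cont_comp)
  qed (use add_dense in blast)
  have scale: "e (c *\<^sub>C x) = c *\<^sub>C e x" for c x
  proof (rule closed_property_on_dense[OF completion_dense, of "\<lambda>x. e (c *\<^sub>C x) = c *\<^sub>C e x"])
    show "closed {x. e (c *\<^sub>C x) = c *\<^sub>C e x}"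
      using continuous_on_compose2[OF continuous_scaleC cont]
      by (intro closed_Collect_eq cont_comp continuous_scaleC) simp
    fix x
    assume "x \<in> \<iota> ` conv_algebra"
    then obtain s where s: "s \<in> conv_algebra" "x = \<iota> s"
      by blast
    have "scale_fun c s \<in> conv_algebra"
      using sections.subspace_scale[OF conv_algebra_subspace] s by blast
    then show "e (c *\<^sub>C x) = c *\<^sub>C e x"
      using e[of "scale_fun c s"] e[of s] s
      by (simp add: completion_scale) (simp add: scale_fun_def)
  qed
  have "module_hom scaleC scaleC e"
    by (simp add: module_hom_def module_hom_axioms_def module_iff_vector_space
        vector_space_scaleC add scale)
  then show ?thesis
    using cont e by (auto simp: module_hom_iff_linear)
qed

lemma linear_eval_at: "Vector_Spaces.linear scaleC scaleC (eval_at \<iota> g)" (is ?linear)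
  and continuous_eval_at: "continuous_on UNIV (eval_at \<iota> g)" (is ?continuous)
  and eval_at_section: "s \<in> conv_algebra \<Longrightarrow> eval_at \<iota> g (\<iota> s) = s g"
proof -
  have "\<exists>!e. Vector_Spaces.linear scaleC scaleC e \<and> continuous_on UNIV e \<and>
       (\<forall>s\<in>conv_algebra. e (\<iota> s) = s g)"
  proof (rule ex_ex1I[OF evaluation_extends])
    fix e e' :: "'a \<Rightarrow> 'f"
    assume e: "Vector_Spaces.linear scaleC scaleC e \<and> continuous_on UNIV e \<and>
        (\<forall>s\<in>conv_algebra. e (\<iota> s) = s g)"
      and e': "Vector_Spaces.linear scaleC scaleC e' \<and> continuous_on UNIV e' \<and>
        (\<forall>s\<in>conv_algebra. e' (\<iota> s) = s g)"
    have "e x = e' x" for x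
    proof (rule closed_property_on_dense[OF completion_dense])
      show "closed {x. e x = e' x}"
        using e e' by (intro closed_Collect_eq) auto
    qed (use e e' in auto)
    then show "e = e'"
      by blast
  qed
  from theI'[OF this]
  show ?linear ?continuous "s \<in> conv_algebra \<Longrightarrow> eval_at \<iota> g (\<iota> s) = s g"
    unfolding eval_at_def by auto
qed

text \<open>The generators vanish outside the bisections that carry them, and the kernel of evaluation at
  a point is a closed subspace.\<close>

lemma eval_at_pstar:
  assumes "a \<in> pstar \<iota> V" "g \<notin> V"
  shows "eval_at \<iota> g a = 0"
proof -
  have hom: "module_hom scaleC scaleC (eval_at \<iota> g)"
    using linear_eval_at by (simp only: module_hom_iff_linear)
  let ?Z = "{a. eval_at \<iota> g a = 0}"
  have "\<iota> ` Cc U \<subseteq> ?Z" if U: "U \<in> bisections" "U \<subseteq> V" for U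
  proof clarify
    fix s :: "'g \<Rightarrow> 'f"
    assume s: "s \<in> Cc U"
    have "eval_at \<iota> g (\<iota> s) = s g"
      by (rule eval_at_section[OF subsetD[OF Cc_subset_conv_algebra[OF U(1)] s]])
    also have "\<dots> = 0"
      using s assms(2) U(2) by (auto simp: Cc_def)
    finally show "eval_at \<iota> g (\<iota> s) = 0" .
  qed
  then have "cspan (\<Union>U\<in>{U \<in> bisections. U \<subseteq> V}. \<iota> ` Cc U) \<subseteq> ?Z"
    unfolding cspan_def
    by (intro module.span_minimal[OF module_hom.axioms(1)[OF hom]]
        module_hom.subspace_kernel[OF hom] UN_least) blast
  moreover have "closed ?Z"
    by (intro closed_Collect_eq continuous_eval_at continuous_intros)
  ultimately show ?thesis
    using assms(1) closure_minimal[of _ ?Z] unfolding pstar_def by blast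
qed

text \<open>An element trivially belongs to \<open>gamma_of\<close> of its own open support, and localizability moves it
  into the corresponding \<open>pstar\<close>, whose elements are controlled pointwise.\<close>

lemma eval_at_outside_open_support:
  assumes "localizable \<iota>" "g \<notin> open_support \<iota> a"
  shows "eval_at \<iota> g a = 0"
proof -
  have "module (scaleC :: complex \<Rightarrow> 'a \<Rightarrow> 'a)"
    using vector_space_scaleC by (simp add: module_iff_vector_space)
  then have "a \<in> cspan {b. open_support \<iota> b \<subseteq> open_support \<iota> a}"
    unfolding cspan_def by (intro module.span_base) simp_all
  then have "a \<in> gamma_of \<iota> (open_support \<iota> a)"
    unfolding gamma_of_def using closure_subset by (rule subsetD[rotated])
  then have "a \<in> pstar \<iota> (open_support \<iota> a)"
    using assms(1) by (simp add: localizable_def open_support_def)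
  then show ?thesis
    using assms(2) by (rule eval_at_pstar)
qed

end


section \<open>Localizability forces the Hausdorff property\<close>

theorem theorem4p5:
  fixes \<iota> :: "('g::etale_groupoid \<Rightarrow> 'f::cstar_algebra) \<Rightarrow> 'a::cstar_algebra"
  assumes nontrivial: "\<exists>x::'f. x \<noteq> 0"
    and completion: "compatible_completion \<iota>"
    and localizable: "localizable \<iota>"
  shows "Hausdorff_space (euclidean :: 'g topology)"
proof (rule ccontr)
  assume "\<not> ?thesis"
  then obtain g h :: 'g where "g \<noteq> h"
    and inseparable: "\<And>A B. open A \<Longrightarrow> open B \<Longrightarrow> g \<in> A \<Longrightarrow> h \<in> B \<Longrightarrow> A \<inter> B \<noteq> {}"
    unfolding Hausdorff_space_def disjnt_def by auto
  have same_gdom: "gdom g = gdom h"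
    by (rule gdom_eq_of_inseparable[OF inseparable])
  obtain U e where U: "U \<in> bisections" "g \<in> U" "openin (top_of_set units) (gdom ` U)"
    "homeomorphism U (gdom ` U) gdom e"
    by (rule bisection_around)
  obtain V e' where V: "V \<in> bisections" "h \<in> V" "openin (top_of_set units) (gdom ` V)"
    "homeomorphism V (gdom ` V) gdom e'"
    by (rule bisection_around)
  have "gdom g \<in> gdom ` U \<inter> gdom ` V"
    using imageI[OF U(2), of gdom] imageI[OF V(2), of gdom] by (simp add: same_gdom)
  then obtain f K where bump: "continuous_map (top_of_set units) euclideanreal f" "f (gdom g) = 1"
    "compactin (top_of_set units) K" "K \<subseteq> gdom ` U \<inter> gdom ` V"
    "\<And>y. y \<in> topspace (top_of_set units) \<Longrightarrow> f y \<noteq> 0 \<Longrightarrow> y \<in> K"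
    by (rule locally_compact_Hausdorff_bump
        [OF locally_compact_units Hausdorff_units openin_Int[OF U(3) V(3)]]) blast
  then have f: "continuous_on units f" "f (gdom g) = 1"
    and K: "compact K" "K \<subseteq> gdom ` U" "K \<subseteq> gdom ` V" "\<And>y. y \<in> units \<Longrightarrow> f y \<noteq> 0 \<Longrightarrow> y \<in> K"
    by (simp_all add: compactin_subtopology)
  obtain v :: 'f where "v \<noteq> 0"
    using nontrivial by blast
  define s where "s k = (if k \<in> U then f (gdom k) *\<^sub>R v else 0)" for k
  define t where "t k = (if k \<in> V then f (gdom k) *\<^sub>R v else 0)" for k
  have "s \<in> Cc U" "t \<in> Cc V"
    using lifted_bump_in_Cc[OF U(4) f(1) K(1,2,4), of v]
      lifted_bump_in_Cc[OF V(4) f(1) K(1,3,4), of v]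
    by (simp_all add: s_def[abs_def] t_def[abs_def])
  then have "s \<in> conv_algebra" "t \<in> conv_algebra"
    using Cc_subset_conv_algebra[OF U(1)] Cc_subset_conv_algebra[OF V(1)] by auto
  then have "s - t \<in> conv_algebra"
    by (rule sections.subspace_diff[OF conv_algebra_subspace])
  then have eval: "eval_at \<iota> k (\<iota> (s - t)) = s k - t k" for k
    by (simp add: eval_at_section[OF completion])
  have "g \<notin> open_support \<iota> (\<iota> (s - t))"
  proof
    assume "g \<in> open_support \<iota> (\<iota> (s - t))"
    then obtain A where A: "open A" "g \<in> A" "\<And>k. k \<in> A \<Longrightarrow> s k \<noteq> t k"
      by (auto simp: open_support_def eval elim!: interiorE)
    have "(A \<inter> U) \<inter> V \<noteq> {}"
      using A U V by (intro inseparable) (auto simp: bisections_def)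
    then obtain k where "k \<in> A" "k \<in> U" "k \<in> V"
      by blast
    then show False
      using A(3)[of k] by (simp add: s_def t_def)
  qed
  from eval_at_outside_open_support[OF completion localizable this]
  have "s g = t g"
    by (simp add: eval)
  moreover have "g \<notin> V"
    using V same_gdom \<open>g \<noteq> h\<close> by (auto simp: bisections_def dest: inj_onD)
  ultimately show False
    using U(2) f(2) \<open>v \<noteq> 0\<close> by (simp add: s_def t_def)
qed

end
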